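(* Fix an integer $n\ge 2$, $\epsilon\in[1/n,1/3]$ and $\rho\in[1/n,1]$. Let $w_1,\ldots,w_n$ be random variables generated by a random process that is independent of the (unknown) sequence $a_1,\ldots,a_n\in[0,1]$. Let $R$ be an algorithm that receives $\{w_i\}_{i\in[n]}$ and a sequence $\{\hat a_i\}_{i\in[n]}$, where each $\hat a_i$ is an arbitrary $(1/w_i,1)$-approximator to $a_i$, and suppose that for every sequence $\{a_i\}$ in $[0,1]$ and every such choice of $\{\hat a_i\}$, $R$ outputs a value $\hat\sigma$ that is a $(\rho,e^\epsilon)$-approximator to $\sigma=\sum_{i\in[n]}a_i$ with probability at least $2/3$. Let $\alpha=\max\{\rho/\epsilon,(6\epsilon)^{-4}\}$. If $\epsilon\in(0,1/48)$ and $\alpha\le n/16$, then there exists an absolute positive constant $C$ such that $$\frac1n\sum_{i\in[n]}\mathbb{E}[w_i]\ge \frac{C}{\epsilon\rho}\log(n/\alpha).$$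
   Context: For $\rho\ge 0$ and $f\ge 1$, a $(\rho,f)$-approximator to a quantity $\tau$ is any number $\hat\tau$ with $\tau/f-\rho\le\hat\tau\le f\tau+\rho$. *)

theory Defs
  imports "HOL-Probability.Probability"
begin

definition approximator :: "real \<Rightarrow> real \<Rightarrow> real \<Rightarrow> real \<Rightarrow> bool" where
  "approximator \<rho> f \<tau> \<tau>' \<longleftrightarrow> \<tau> / f - \<rho> \<le> \<tau>' \<and> \<tau>' \<le> f * \<tau> + \<rho>"

abbreviation vecs :: "nat \<Rightarrow> (nat \<Rightarrow> real) measure" where
  "vecs n \<equiv> PiM {1..n} (\<lambda>_. borel)"

text \<open>
  The random process is represented by the joint law W of (w_1, ..., w_n), so that w_i is the i-th
  coordinate on the probability space W. No independence or identical distribution is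
  assumed. (Using the law rather than random variables on a sample space of arbitrary type 'a
  keeps an absolute constant from depending on 'a.)
  Positivity is what makes the accuracy 1/w_i meaningful.
\<close>

definition precision_law :: "nat \<Rightarrow> (nat \<Rightarrow> real) measure \<Rightarrow> bool" where
  "precision_law n W \<longleftrightarrow> prob_space W \<and> sets W = sets (vecs n) \<and>
     (AE w in W. \<forall>i\<in>{1..n}. 0 < w i)"

text \<open>
  A choice of approximators to a may depend on the realised w; g w is the resulting vector of
  approximators. Measurability is needed for success to be an event.
\<close>

definition approximator_choice ::
    "nat \<Rightarrow> (nat \<Rightarrow> real) measure \<Rightarrow> (nat \<Rightarrow> real) \<Rightarrow> ((nat \<Rightarrow> real) \<Rightarrow> nat \<Rightarrow> real) \<Rightarrow> bool" where
  "approximator_choice n W a g \<longleftrightarrow> g \<in> vecs n \<rightarrow>\<^sub>M vecs n \<and>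
     (AE w in W. \<forall>i\<in>{1..n}. approximator (1 / w i) 1 (a i) (g w i))"

text \<open>
  The algorithm may use internal randomness: given the two received vectors, it produces a
  distribution of outputs. A deterministic algorithm is the case of Dirac measures. The
  approximators are chosen without access to the internal randomness.
\<close>

definition randomized_algorithm ::
    "nat \<Rightarrow> ((nat \<Rightarrow> real) \<times> (nat \<Rightarrow> real) \<Rightarrow> real measure) \<Rightarrow> bool" where
  "randomized_algorithm n R \<longleftrightarrow> R \<in> vecs n \<Otimes>\<^sub>M vecs n \<rightarrow>\<^sub>M prob_algebra borel"

text \<open>
  The Giry bind below is the law of the output when w is drawn from W and R is then run on
  w and g w, so the probability is over both w and the randomness of R.
\<close>

definition estimates_sum ::
    "nat \<Rightarrow> real \<Rightarrow> real \<Rightarrow> (nat \<Rightarrow> real) measure \<Rightarrow>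
     ((nat \<Rightarrow> real) \<times> (nat \<Rightarrow> real) \<Rightarrow> real measure) \<Rightarrow> bool" where
  "estimates_sum n \<epsilon> \<rho> W R \<longleftrightarrow>
     (\<forall>a g. (\<forall>i\<in>{1..n}. a i \<in> {0..1}) \<longrightarrow> approximator_choice n W a g \<longrightarrow>
        measure (W \<bind> (\<lambda>w. R (w, g w)))
          {s. approximator \<rho> (exp \<epsilon>) (\<Sum>i\<in>{1..n}. a i) s} \<ge> 2 / 3)"

end

theory Submission
  imports Defs
begin

text \<open>
  Give every coordinate the value v = 1/t independently with probability q or (1 + \<delta>) q, where
  \<delta> = 24\<epsilon> and the expected sum is \<rho>/\<epsilon> in the first case. The two sums are
  far enough apart for R to tell them apart. But 0 is a legitimate approximator for the value v
  wherever w_i < t, so R learns nothing outside V = {i. t \<le> w_i}, and the \<chi>-square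
  distance on V is of order \<delta>^2 q |V|. Hence the expected size of V is at least of order
  1/(\<delta>^2 q), that is n/(\<epsilon>\<rho>t). Summing over dyadic t between 1/(2\<epsilon>\<rho>) and
  \<epsilon>n/(2\<rho>), a range of ratio \<epsilon>^2 n \<ge> n/\<alpha>, gives the logarithm.
\<close>

section \<open>Independent Bernoulli bits: concentration and change of measure\<close>

abbreviation bernoulli_bits :: "'a set \<Rightarrow> real \<Rightarrow> ('a \<Rightarrow> bool) pmf" where
  "bernoulli_bits V q \<equiv> Pi_pmf V False (\<lambda>_. bernoulli_pmf q)"

lemma finite_set_bernoulli_bits:
  "finite V \<Longrightarrow> finite (set_pmf (bernoulli_bits V q))"
  by (auto simp: set_Pi_pmf intro!: finite_PiE_dflt)

lemma integrable_bernoulli_bits [simp]: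
  fixes f :: "('a \<Rightarrow> bool) \<Rightarrow> real"
  shows "finite V \<Longrightarrow> integrable (measure_pmf (bernoulli_bits V q)) f"
  by (intro integrable_measure_pmf_finite finite_set_bernoulli_bits)

text \<open>For negative x, exp x \<le> 1 / (1 - x), while (1 + x + x^2) (1 - x) = 1 - x^3 \<ge> 1.
  Negative arguments matter because lower tails are obtained from a negative
  \<open>l\<close>.\<close>

lemma exp_le_quadratic:
  fixes x :: real
  assumes "x \<le> 1"
  shows "exp x \<le> 1 + x + x\<^sup>2"
proof (cases "0 \<le> x")
  case True
  then show ?thesis using assms by (rule exp_bound)
next
  case False
  have "1 - x \<le> exp (-x)" using exp_ge_add_one_self[of "-x"] by simp
  then have "exp x * (1 - x) \<le> 1"
    by (metis exp_ge_zero exp_minus_inverse mult_left_mono)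
  also have "1 \<le> (1 + x + x\<^sup>2) * (1 - x)"
  proof -
    have "x * x\<^sup>2 \<le> 0" using False by (intro mult_nonpos_nonneg) auto
    then show ?thesis by (simp add: algebra_simps power2_eq_square)
  qed
  finally show ?thesis using False by (simp add: mult_le_cancel_right)
qed

text \<open>Independence factorises the moment generating function; each factor 1 + q (exp l - 1) is
  at most exp (q (l + l^2)), and centring removes the linear term.\<close>

lemma bernoulli_bits_mgf:
  assumes "finite V" "0 \<le> q" "q \<le> 1" "l \<le> 1"
  shows "measure_pmf.expectation (bernoulli_bits V q)
           (\<lambda>A. exp (l * (real (card {i\<in>V. A i}) - real (card V) * q)))
         \<le> exp (real (card V) * q * l\<^sup>2)"
proof -
  have *: "exp (l * real (card {i\<in>V. A i})) = (\<Prod>i\<in>V. if A i then exp l else 1)" for A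
  proof -
    have "exp (l * real (card {i\<in>V. A i})) = (\<Prod>i\<in>{i\<in>V. A i}. exp l)"
      by (simp add: exp_of_nat2_mult)
    also have "\<dots> = (\<Prod>i\<in>V. if A i then exp l else 1)"
      using assms(1) by (simp add: prod.If_cases Int_def)
    finally show ?thesis .
  qed
  have "measure_pmf.expectation (bernoulli_bits V q) (\<lambda>A. exp (l * real (card {i\<in>V. A i})))
     = (\<Prod>i\<in>V. measure_pmf.expectation (bernoulli_pmf q) (\<lambda>b. if b then exp l else 1))"
    unfolding * using assms
    by (intro expectation_prod_Pi_pmf[where f = "\<lambda>_ b. if b then exp l else 1"])
       (auto intro!: integrable_measure_pmf_finite)
  also have "\<dots> = (1 + q * (exp l - 1)) ^ card V"
    using assms by (simp add: algebra_simps)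
  also have "\<dots> \<le> exp (q * (l + l\<^sup>2)) ^ card V"
  proof (rule power_mono)
    have "1 + q * (exp l - 1) \<le> 1 + q * (l + l\<^sup>2)"
      using exp_le_quadratic[OF assms(4)] assms by (intro add_left_mono mult_left_mono) auto
    also have "\<dots> \<le> exp (q * (l + l\<^sup>2))" by (rule exp_ge_add_one_self)
    finally show "1 + q * (exp l - 1) \<le> exp (q * (l + l\<^sup>2))" .
    have "0 \<le> (1 - q) + q * exp l" using assms by (intro add_nonneg_nonneg) auto
    then show "0 \<le> 1 + q * (exp l - 1)" by (simp add: algebra_simps)
  qed
  also have "\<dots> = exp (real (card V) * (q * (l + l\<^sup>2)))"
    by (simp add: exp_of_nat_mult)
  finally have "measure_pmf.expectation (bernoulli_bits V q)
      (\<lambda>A. exp (l * real (card {i\<in>V. A i}))) * exp (- l * real (card V) * q)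
      \<le> exp (real (card V) * (q * (l + l\<^sup>2))) * exp (- l * real (card V) * q)"
    by (intro mult_right_mono) auto
  also have "\<dots> = exp (real (card V) * q * l\<^sup>2)"
    by (simp flip: exp_add add: algebra_simps)
  finally show ?thesis
    by (subst (asm) integral_mult_left_zero[symmetric])
       (simp flip: exp_add add: algebra_simps)
qed

text \<open>Chernoff bound: the indicator of the event is dominated by the exponential of the excess
  over x. The sign of \<open>l\<close> selects the upper or the lower tail.\<close>

lemma bernoulli_bits_tail:
  assumes "finite V" "0 \<le> q" "q \<le> 1" "l \<le> 1"
  shows "measure_pmf.prob (bernoulli_bits V q)
           {A. x \<le> l * (real (card {i\<in>V. A i}) - real (card V) * q)}
         \<le> exp (real (card V) * q * l\<^sup>2 - x)"
proof -
  let ?S = "{A. x \<le> l * (real (card {i\<in>V. A i}) - real (card V) * q)}"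
  have "measure_pmf.prob (bernoulli_bits V q) ?S
      = measure_pmf.expectation (bernoulli_bits V q) (indicator ?S)"
    by simp
  also have "\<dots> \<le> measure_pmf.expectation (bernoulli_bits V q)
      (\<lambda>A. exp (l * (real (card {i\<in>V. A i}) - real (card V) * q)) * exp (-x))"
    using assms(1) by (intro integral_mono) (auto simp: indicator_def simp flip: exp_add)
  also have "\<dots> \<le> exp (real (card V) * q * l\<^sup>2) * exp (-x)"
    using bernoulli_bits_mgf[OF assms] by simp
  finally show ?thesis by (simp flip: exp_add)
qed

text \<open>The product is the likelihood ratio. Both laws live on the finite set of bit vectors
  that are False off \<open>V\<close>, and 0 < q < 1 gives each of these positive mass under the
  reference law, so the densities can be compared vector by vector.\<close>

lemma bernoulli_bits_change_of_measure:
  fixes f :: "('a \<Rightarrow> bool) \<Rightarrow> real"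
  assumes "finite V" "0 < q" "q < 1" "0 \<le> q'" "q' \<le> 1"
  shows "measure_pmf.expectation (bernoulli_bits V q') f
       = measure_pmf.expectation (bernoulli_bits V q)
           (\<lambda>A. (\<Prod>i\<in>V. if A i then q' / q else (1 - q') / (1 - q)) * f A)"
proof -
  let ?S = "PiE_dflt V False (\<lambda>_. UNIV :: bool set)"
  have fin: "finite ?S" using assms(1) by (intro finite_PiE_dflt) auto
  have sub: "set_pmf (bernoulli_bits V r) \<subseteq> ?S" for r
    using assms(1) by (auto simp: set_Pi_pmf PiE_dflt_def)
  have "measure_pmf.expectation (bernoulli_bits V q') f
      = (\<Sum>A\<in>?S. f A * pmf (bernoulli_bits V q') A)"
    using fin sub by (intro integral_measure_pmf_real) auto
  also have "\<dots> = (\<Sum>A\<in>?S. (\<Prod>i\<in>V. if A i then q' / q else (1 - q') / (1 - q)) * f A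
      * pmf (bernoulli_bits V q) A)"
  proof (rule sum.cong)
    fix A assume "A \<in> ?S"
    then have A: "\<And>x. x \<notin> V \<Longrightarrow> A x = False" by (auto simp: PiE_dflt_def)
    have pm: "pmf (bernoulli_bits V p) A = (\<Prod>i\<in>V. pmf (bernoulli_pmf p) (A i))" for p
      using assms(1) A by (intro pmf_Pi') auto
    have "pmf (bernoulli_bits V q') A
        = (\<Prod>i\<in>V. (if A i then q' / q else (1 - q') / (1 - q)) * pmf (bernoulli_pmf q) (A i))"
      unfolding pm using assms by (intro prod.cong) (auto simp: pmf_bernoulli_True pmf_bernoulli_False)
    then show "f A * pmf (bernoulli_bits V q') A
        = (\<Prod>i\<in>V. if A i then q' / q else (1 - q') / (1 - q)) * f A * pmf (bernoulli_bits V q) A"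
      unfolding pm by (simp add: prod.distrib)
  qed simp
  also have "\<dots> = measure_pmf.expectation (bernoulli_bits V q)
           (\<lambda>A. (\<Prod>i\<in>V. if A i then q' / q else (1 - q') / (1 - q)) * f A)"
    using fin sub by (intro integral_measure_pmf_real[symmetric]) auto
  finally show ?thesis .
qed

text \<open>The additive 1/20 buys a bound linear in \<open>card V\<close> where the \<chi>-square
  distance alone would give a square root. For a random \<open>V\<close>, linearity lets the bound
  be integrated to an expected cardinality.\<close>

lemma bernoulli_bits_indistinguishable:
  fixes f :: "('a \<Rightarrow> bool) \<Rightarrow> real"
  assumes "finite V" "0 < q" "q \<le> 1 / 2" "0 \<le> \<delta>" "\<delta> \<le> 1 / 2"
    and f: "\<And>A. 0 \<le> f A" "\<And>A. f A \<le> 1"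
  shows "measure_pmf.expectation (bernoulli_bits V q) f
       - measure_pmf.expectation (bernoulli_bits V ((1 + \<delta>) * q)) f
       \<le> 20 * \<delta>\<^sup>2 * q * real (card V) + 1 / 20"
proof (cases "2 * \<delta>\<^sup>2 * q * real (card V) \<le> 1")
  \<comment> \<open>Here the right-hand side already exceeds 10. The other case keeps the exponent
    below 1, so that exp can be linearised.\<close>
  case False
  have "measure_pmf.expectation (bernoulli_bits V q) f \<le> 1"
    using measure_pmf.integral_le_const[of "bernoulli_bits V q" f 1] assms by simp
  moreover have "0 \<le> measure_pmf.expectation (bernoulli_bits V ((1 + \<delta>) * q)) f"
    using f by simp
  ultimately show ?thesis using False by simp
next
  case True
  define q' where "q' = (1 + \<delta>) * q"
  have q': "0 < q'" "q' \<le> 1"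
    using assms mult_mono[of "1+\<delta>" "3/2" q "1/2"] by (auto simp: q'_def)
  let ?E = "measure_pmf.expectation (bernoulli_bits V q)"
  define r where "r b = (if b then q' / q else (1 - q') / (1 - q))" for b :: bool
  \<comment> \<open>L is the likelihood ratio; E |L - 1| is bounded by the \<chi>-square distance via
    |x| \<le> 5 x^2 + 1/20.\<close>
  define L where "L A = (\<Prod>i\<in>V. r (A i))" for A
  have q1: "q < 1" using assms by simp
  note change = bernoulli_bits_change_of_measure[OF assms(1,2) q1, of q']
  have EL: "?E L = 1"
    using change[of "\<lambda>_. 1"] q' by (simp add: L_def[abs_def] r_def)
  have r0: "0 \<le> r b" for b using q' assms by (auto simp: r_def)
  have "?E (\<lambda>A. (L A)\<^sup>2) = ?E (\<lambda>A. \<Prod>i\<in>V. (r (A i))\<^sup>2)"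
    by (simp add: L_def prod_power_distrib)
  also have "\<dots> = (\<Prod>i\<in>V. measure_pmf.expectation (bernoulli_pmf q) (\<lambda>b. (r b)\<^sup>2))"
    using assms by (intro expectation_prod_Pi_pmf[where f = "\<lambda>_ b. (r b)\<^sup>2"])
       (auto intro!: integrable_measure_pmf_finite)
  \<comment> \<open>One plus the \<chi>-square distance for a single bit. The terms linear in
    \<delta> cancel between the two outcomes because the ratio has mean 1.\<close>
  also have "measure_pmf.expectation (bernoulli_pmf q) (\<lambda>b. (r b)\<^sup>2) = 1 + \<delta>\<^sup>2 * q / (1 - q)"
  proof -
    define p where "p = 1 - q"
    have p: "0 < p" "q = 1 - p" using q1 by (auto simp: p_def)
    have "(r True)\<^sup>2 * q = (1 + \<delta>)\<^sup>2 * q"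
      using assms by (simp add: r_def q'_def)
    moreover have "(r False)\<^sup>2 * p = p - 2 * \<delta> * q + \<delta>\<^sup>2 * q\<^sup>2 / p"
    proof -
      have "1 - q' = p - \<delta> * q" by (simp add: q'_def p_def algebra_simps)
      then have "r False = (p - \<delta> * q) / p" by (simp add: r_def flip: p_def)
      then have "(r False)\<^sup>2 * p = (p - \<delta> * q)\<^sup>2 / p"
        using p(1) by (simp add: power2_eq_square)
      also have "\<dots> = p - 2 * \<delta> * q + \<delta>\<^sup>2 * q\<^sup>2 / p"
        using p(1) by (simp add: field_simps power2_eq_square)
      finally show ?thesis .
    qed
    moreover have "\<delta>\<^sup>2 * q / p = \<delta>\<^sup>2 * q + \<delta>\<^sup>2 * q\<^sup>2 / p"
      using p(1) unfolding p(2) by (simp add: field_simps power2_eq_square)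
    ultimately show ?thesis
      using assms by (simp flip: p_def) (simp add: p(2) power2_eq_square algebra_simps)
  qed
  also have "(\<Prod>i\<in>V. 1 + \<delta>\<^sup>2 * q / (1 - q)) \<le> exp (2 * \<delta>\<^sup>2 * q) ^ card V"
    unfolding prod_constant
  proof (rule power_mono)
    have "1 / (1 - q) \<le> 2" using assms by (simp add: field_simps)
    then have "\<delta>\<^sup>2 * q * (1 / (1 - q)) \<le> \<delta>\<^sup>2 * q * 2"
      using assms by (intro mult_left_mono) auto
    then have "1 + \<delta>\<^sup>2 * q / (1 - q) \<le> 1 + 2 * \<delta>\<^sup>2 * q" by simp
    also have "\<dots> \<le> exp (2 * \<delta>\<^sup>2 * q)" by (rule exp_ge_add_one_self)
    finally show "1 + \<delta>\<^sup>2 * q / (1 - q) \<le> exp (2 * \<delta>\<^sup>2 * q)" .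
    show "0 \<le> 1 + \<delta>\<^sup>2 * q / (1 - q)" using assms by simp
  qed
  also have "\<dots> = exp (2 * \<delta>\<^sup>2 * q * real (card V))"
    by (simp add: exp_of_nat2_mult)
  also have "\<dots> \<le> 1 + 2 * (2 * \<delta>\<^sup>2 * q * real (card V))"
  proof -
    define x where "x = 2 * \<delta>\<^sup>2 * q * real (card V)"
    have x: "0 \<le> x" "x \<le> 1" using True assms by (auto simp: x_def)
    then have "x\<^sup>2 \<le> x" by (simp add: power2_eq_square mult_left_le_one_le)
    with exp_bound[OF x] show ?thesis unfolding x_def[symmetric] by simp
  qed
  finally have EL2: "?E (\<lambda>A. (L A)\<^sup>2) \<le> 1 + 4 * \<delta>\<^sup>2 * q * real (card V)" by simp
  have "?E f - measure_pmf.expectation (bernoulli_bits V q') f = ?E (\<lambda>A. f A - L A * f A)"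
    using change[of f] q' assms(1) by (simp add: L_def r_def)
  also have "\<dots> \<le> ?E (\<lambda>A. 5 * (L A)\<^sup>2 - 10 * L A + (5 + 1 / 20))"
  proof (rule integral_mono)
    fix A
    have "f A - L A * f A = (1 - L A) * f A" by (simp add: algebra_simps)
    also have "\<dots> \<le> \<bar>1 - L A\<bar> * 1"
      using f by (intro mult_mono) auto
    also have "\<dots> \<le> 5 * (1 - L A)\<^sup>2 + 1 / 20"
    proof -
      have "0 \<le> 5 * (\<bar>1 - L A\<bar> - 1 / 10)\<^sup>2" by simp
      also have "\<dots> = 5 * (1 - L A)\<^sup>2 - \<bar>1 - L A\<bar> + 1 / 20"
        by (simp add: power2_diff) (simp add: algebra_simps power2_eq_square)
      finally show ?thesis by simp
    qed
    also have "\<dots> = 5 * (L A)\<^sup>2 - 10 * L A + (5 + 1 / 20)"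
      by (simp add: power2_eq_square algebra_simps)
    finally show "f A - L A * f A \<le> 5 * (L A)\<^sup>2 - 10 * L A + (5 + 1 / 20)" .
  qed (use assms in simp_all)
  also have "\<dots> = 5 * ?E (\<lambda>A. (L A)\<^sup>2) - 10 * ?E L + (5 + 1 / 20)"
    using assms(1) by simp
  also have "\<dots> \<le> 20 * \<delta>\<^sup>2 * q * real (card V) + 1 / 20"
    using EL EL2 by simp
  finally show ?thesis by (simp add: q'_def)
qed

text \<open>A geometric sum is at most twice its largest term. If the top scale is at most x, all
  indicators may be replaced by 1; otherwise the top term vanishes and induction applies.\<close>

lemma dyadic_sum_le:
  fixes x T :: real
  assumes "0 \<le> x" "0 \<le> T"
  shows "(\<Sum>j<J. 2 ^ j * T * (if 2 ^ j * T \<le> x then 1 else 0)) \<le> 2 * x"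
proof (induction J)
  case (Suc J)
  show ?case
  proof (cases "2 ^ J * T \<le> x")
    case True
    have "(\<Sum>j<Suc J. 2 ^ j * T * (if 2 ^ j * T \<le> x then 1 else 0)) \<le> (\<Sum>j<Suc J. 2 ^ j * T)"
      using assms by (intro sum_mono) auto
    also have "\<dots> = (2 ^ Suc J - 1) * T"
      by (simp only: sum_distrib_right[symmetric] sum_gp_strict) simp
    also have "\<dots> \<le> 2 * x" using True assms by (simp add: algebra_simps)
    finally show ?thesis .
  qed (use Suc in simp)
qed (use assms in simp)


text \<open>Finite support turns the outer expectation into a finite sum, so the interchange is
  linearity of the integral and needs integrability only for each fixed \<open>A\<close>.\<close>

lemma
  fixes f :: "'a \<Rightarrow> 'b \<Rightarrow> real"
  assumes "finite (set_pmf p)" "\<And>A. integrable W (f A)"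
  shows integrable_pmf_expectation: "integrable W (\<lambda>w. measure_pmf.expectation p (\<lambda>A. f A w))"
    and integral_pmf_expectation_swap:
      "measure_pmf.expectation p (\<lambda>A. \<integral>w. f A w \<partial>W)
       = (\<integral>w. measure_pmf.expectation p (\<lambda>A. f A w) \<partial>W)"
proof -
  have *: "measure_pmf.expectation p g = (\<Sum>A\<in>set_pmf p. g A * pmf p A)" for g :: "'a \<Rightarrow> real"
    using assms(1) by (intro integral_measure_pmf_real) auto
  show "integrable W (\<lambda>w. measure_pmf.expectation p (\<lambda>A. f A w))"
    unfolding * using assms(2) by auto
  show "measure_pmf.expectation p (\<lambda>A. \<integral>w. f A w \<partial>W)
       = (\<integral>w. measure_pmf.expectation p (\<lambda>A. f A w) \<partial>W)"
    unfolding * using assms(2) by (subst Bochner_Integration.integral_sum) auto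
qed

text \<open>The means \<rho>/\<epsilon> and (1 + 24\<epsilon>) \<rho>/\<epsilon> differ by 24\<rho>.
  Deviations of 9\<rho> on both sides use 18\<rho>, the two additive errors 2\<rho>, and the two
  factors exp \<epsilon> about 2\<rho>. The remaining 2\<rho> covers the terms of higher order, as
  \<epsilon> < 1/48.\<close>

lemma approximator_intervals_separated:
  fixes \<epsilon> \<rho> :: real
  assumes "0 < \<epsilon>" "\<epsilon> < 1 / 48" "0 < \<rho>"
  shows "exp \<epsilon> * (\<rho> / \<epsilon> + 9 * \<rho>) + \<rho> < ((1 + 24 * \<epsilon>) * (\<rho> / \<epsilon>) - 9 * \<rho>) / exp \<epsilon> - \<rho>"
proof -
  have e2: "\<epsilon> * \<epsilon> < \<epsilon> / 48" using mult_strict_left_mono[OF assms(2,1)] by simp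
  have "\<epsilon> * (\<epsilon> * \<epsilon>) \<le> 1 * (\<epsilon> * \<epsilon>)" using assms by (intro mult_right_mono) auto
  with e2 have e3: "\<epsilon> * (\<epsilon> * \<epsilon>) < \<epsilon> / 48" by linarith
  have "exp \<epsilon> * (1 + 9 * \<epsilon>) + \<epsilon> \<le> (1 + \<epsilon> + \<epsilon>\<^sup>2) * (1 + 9 * \<epsilon>) + \<epsilon>"
    using exp_bound[of \<epsilon>] assms by (intro add_mono mult_right_mono) auto
  also have "\<dots> < (1 - \<epsilon>) * (1 + 15 * \<epsilon>) - \<epsilon>"
  proof -
    have "(1 + \<epsilon> + \<epsilon>\<^sup>2) * (1 + 9 * \<epsilon>) + \<epsilon> = 1 + 11 * \<epsilon> + 10 * (\<epsilon> * \<epsilon>) + 9 * (\<epsilon> * (\<epsilon> * \<epsilon>))"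
      and "(1 - \<epsilon>) * (1 + 15 * \<epsilon>) - \<epsilon> = 1 + 13 * \<epsilon> - 15 * (\<epsilon> * \<epsilon>)"
      by (simp_all add: algebra_simps power2_eq_square)
    with e2 e3 assms(1) show ?thesis by linarith
  qed
  also have "\<dots> \<le> exp (- \<epsilon>) * (1 + 15 * \<epsilon>) - \<epsilon>"
    using exp_ge_add_one_self[of "-\<epsilon>"] assms by (intro diff_mono mult_right_mono) auto
  finally have "(\<rho> / \<epsilon>) * (exp \<epsilon> * (1 + 9 * \<epsilon>) + \<epsilon>)
      < (\<rho> / \<epsilon>) * (exp (- \<epsilon>) * (1 + 15 * \<epsilon>) - \<epsilon>)"
    using assms by (intro mult_strict_left_mono) auto
  also have "(\<rho> / \<epsilon>) * (exp (- \<epsilon>) * (1 + 15 * \<epsilon>) - \<epsilon>)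
      = ((1 + 24 * \<epsilon>) * (\<rho> / \<epsilon>) - 9 * \<rho>) / exp \<epsilon> - \<rho>"
    using assms by (simp add: exp_minus field_simps)
  finally show ?thesis using assms by (simp add: algebra_simps)
qed

text \<open>One scale t of the argument. The lower limit on t gives \<rho>\<epsilon>t \<ge> 1/2, on
  which concentration and v \<le> 1 rest; the upper limit amounts to q \<le> 1/2.\<close>

lemma tail_sum_lower_bound:
  fixes \<epsilon> \<rho> t :: real
  assumes W: "precision_law n W" and R: "randomized_algorithm n R"
    and est: "estimates_sum n \<epsilon> \<rho> W R"
    and \<epsilon>: "0 < \<epsilon>" "\<epsilon> < 1 / 48" and \<rho>: "0 < \<rho>" "\<rho> \<le> 1"
    and t: "1 / (2 * \<epsilon> * \<rho>) \<le> t" "t \<le> \<epsilon> * real n / (2 * \<rho>)"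
  shows "real n / (115200 * \<epsilon> * \<rho> * t) \<le> (\<Sum>i\<in>{1..n}. measure W {w\<in>space W. t \<le> w i})"
proof -
  interpret W: prob_space W using W by (simp add: precision_law_def)
  have sets_W [measurable_cong]: "sets W = sets (vecs n)"
    and pos: "AE w in W. \<forall>i\<in>{1..n}. 0 < w i"
    using W by (auto simp: precision_law_def)
  have space_W: "space W = space (vecs n)" using sets_W by (rule sets_eq_imp_space_eq)
  have R' [measurable]: "R \<in> vecs n \<Otimes>\<^sub>M vecs n \<rightarrow>\<^sub>M prob_algebra borel"
    using R by (simp add: randomized_algorithm_def)
  have "0 < 1 / (2 * \<epsilon> * \<rho>)" using \<epsilon> \<rho> by simp
  then have t0: "0 < t" using t by linarith
  have "0 < \<epsilon> * real n / (2 * \<rho>)" using t0 t by linarith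
  then have n: "0 < real n" using \<epsilon> \<rho> by (simp add: zero_less_divide_iff zero_less_mult_iff)
  have \<rho>\<epsilon>t: "1 / 2 \<le> \<rho> * \<epsilon> * t" using t(1) \<epsilon> \<rho> by (simp add: field_simps)

  \<comment> \<open>The hard instance and its parameters\<close>
  define N where "N = {1..n}"
  have finN: "finite N" and cardN: "card N = n" by (simp_all add: N_def)
  define v where "v = 1 / t"
  \<comment> \<open>Chosen so that n q v = \<rho>/\<epsilon>, the size of sum at which the relative
    error exp \<epsilon> and the additive error \<rho> are comparable.\<close>
  define q where "q = \<rho> * t / (\<epsilon> * real n)"
  define \<delta> where "\<delta> = 24 * \<epsilon>"
  define q' where "q' = (1 + \<delta>) * q"
  \<comment> \<open>The largest output acceptable for a sum 9\<rho> above the smaller mean. By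
    \<open>approximator_intervals_separated\<close> it lies below every output acceptable for a sum
    9\<rho> under the larger mean.\<close>
  define \<theta> where "\<theta> = exp \<epsilon> * (\<rho> / \<epsilon> + 9 * \<rho>) + \<rho>"
  have v: "0 < v" "v \<le> 1"
  proof -
    have "\<rho> * \<epsilon> * t \<le> 1 * (1 / 48) * t"
      using \<epsilon> \<rho> t0 by (intro mult_right_mono mult_mono) auto
    with \<rho>\<epsilon>t have "1 \<le> t" by simp
    then show "0 < v" "v \<le> 1" by (auto simp: v_def)
  qed
  have q: "0 < q" "q \<le> 1 / 2"
    using t(2) t0 \<epsilon> \<rho> n by (auto simp: q_def field_simps)
  have \<delta>: "0 < \<delta>" "\<delta> \<le> 1 / 2" using \<epsilon> by (auto simp: \<delta>_def)
  have q': "0 < q'" "q' \<le> 1"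
    using mult_mono[of "1+\<delta>" "3/2" q "1/2"] q \<delta> by (auto simp: q'_def)
  have nq: "real n * q = \<rho> * t / \<epsilon>" using n by (simp add: q_def)
  have vnq: "v * (real n * q) = \<rho> / \<epsilon>" using t0 unfolding nq by (simp add: v_def)

  \<comment> \<open>Approximators that hide the bits outside \<open>V w\<close>\<close>
  define G where "G A = (\<lambda>i\<in>N. if A i then v else 0)" for A :: "nat \<Rightarrow> bool"
  define V where "V w = {i\<in>N. t \<le> w i}" for w :: "nat \<Rightarrow> real"
  define g where "g A w = (\<lambda>i\<in>N. if t \<le> w i \<and> A i then v else 0)"
    for A :: "nat \<Rightarrow> bool" and w :: "nat \<Rightarrow> real"
  define a where "a A i = (if A i then v else 0)" for A :: "nat \<Rightarrow> bool" and i :: nat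
  define X where "X A = real (card {i\<in>N. A i})" for A :: "nat \<Rightarrow> bool"
  \<comment> \<open>What \<open>R\<close> receives depends on \<open>A\<close> only through its bits
    in \<open>V w\<close>. The padding by False matches the default value in \<open>Pi_pmf\<close>,
    as projecting the product law onto \<open>V w\<close> requires.\<close>
  have g_eq: "g A w = G (\<lambda>i. if i \<in> V w then A i else False)" for A w
    by (auto simp: g_def G_def V_def restrict_def)
  have g_meas [measurable]: "g A \<in> vecs n \<rightarrow>\<^sub>M vecs n" for A
    unfolding g_def N_def by measurable
  have G_space: "G A \<in> space (vecs n)" for A
    by (auto simp: G_def N_def space_PiM)
  have sum_a: "(\<Sum>i\<in>{1..n}. a A i) = v * X A" for A
    unfolding N_def[symmetric] by (simp add: a_def X_def sum.If_cases finN Int_def)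
  have choice: "approximator_choice n W (a A) (g A)" for A
    unfolding approximator_choice_def
  proof
    show "g A \<in> vecs n \<rightarrow>\<^sub>M vecs n" by (rule g_meas)
    show "AE w in W. \<forall>i\<in>{1..n}. approximator (1 / w i) 1 (a A i) (g A w i)"
      using pos
    proof eventually_elim
      case (elim w)
      show ?case
      proof
        fix i assume i: "i \<in> {1..n}"
        with elim have wi: "0 < w i" by auto
        have "v \<le> 1 / w i" if "\<not> t \<le> w i"
          unfolding v_def using that wi by (intro divide_left_mono) auto
        then show "approximator (1 / w i) 1 (a A i) (g A w i)"
          using i wi v by (auto simp: approximator_def a_def g_def N_def)
      qed
    qed
  qed

  \<comment> \<open>The algorithm as a threshold test: \<open>F A\<close> is the probability of an
    output at most \<theta>\<close>
  define K where "K A = W \<bind> (\<lambda>w. R (w, g A w))" for A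
  define Q where "Q A = {s. approximator \<rho> (exp \<epsilon>) (v * X A) s}" for A
  define F where "F A = measure (K A) {..\<theta>}" for A
  have kern: "(\<lambda>w. R (w, g A w)) \<in> W \<rightarrow>\<^sub>M prob_algebra borel" for A
    by measurable
  have K: "prob_space (K A)" "sets (K A) = sets borel" for A
  proof -
    have WW: "W \<in> space (prob_algebra W)"
      by (simp add: space_prob_algebra W.prob_space_axioms)
    show "prob_space (K A)" unfolding K_def by (rule prob_space_bind'[OF WW kern])
    show "sets (K A) = sets borel" unfolding K_def by (rule sets_bind'[OF WW kern])
  qed
  have Q_sets: "Q A \<in> sets (K A)" for A
  proof -
    have "Q A = {v * X A / exp \<epsilon> - \<rho>..exp \<epsilon> * (v * X A) + \<rho>}"
      by (auto simp: Q_def approximator_def)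
    then show ?thesis by (simp add: K)
  qed
  have success: "2 / 3 \<le> measure (K A) (Q A)" for A
  proof -
    have "\<forall>i\<in>{1..n}. a A i \<in> {0..1}" using v by (auto simp: a_def)
    with est choice[of A] show ?thesis
      unfolding estimates_sum_def K_def Q_def sum_a[symmetric] by blast
  qed
  have F01: "0 \<le> F A" "F A \<le> 1" for A
    using prob_space.prob_le_1[OF K(1)] by (auto simp: F_def)
  have F_low: "2 / 3 \<le> F A" if "X A < real n * q + 9 * \<rho> * t" for A
  proof -
    interpret K: prob_space "K A" by (rule K)
    have "v * X A \<le> v * (real n * q + 9 * \<rho> * t)" using that v by (intro mult_left_mono) auto
    also have "\<dots> = \<rho> / \<epsilon> + 9 * \<rho>"
      using vnq t0 by (simp add: distrib_left) (simp add: v_def)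
    finally have "exp \<epsilon> * (v * X A) + \<rho> \<le> \<theta>" by (simp add: \<theta>_def)
    then have "Q A \<subseteq> {..\<theta>}" by (auto simp: Q_def approximator_def)
    then have "measure (K A) (Q A) \<le> F A"
      unfolding F_def by (intro K.finite_measure_mono) (auto simp: K)
    with success[of A] show ?thesis by simp
  qed
  \<comment> \<open>All acceptable outputs now lie strictly above \<theta>, so only a failure of
    \<open>R\<close> can produce an output at most \<theta>.\<close>
  have F_high: "F A \<le> 1 / 3" if "X A > real n * q' - 9 * \<rho> * t" for A
  proof -
    interpret K: prob_space "K A" by (rule K)
    have "(1 + 24 * \<epsilon>) * (\<rho> / \<epsilon>) - 9 * \<rho> = v * (real n * q' - 9 * \<rho> * t)"
    proof -
      have "v * (real n * q' - 9 * \<rho> * t) = (1 + \<delta>) * (v * (real n * q)) - 9 * \<rho> * (v * t)"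
        by (simp add: q'_def algebra_simps)
      then show ?thesis using t0 by (simp only: vnq) (simp add: \<delta>_def v_def)
    qed
    also have "\<dots> \<le> v * X A" using that v by (intro mult_left_mono) auto
    finally have "((1 + 24 * \<epsilon>) * (\<rho> / \<epsilon>) - 9 * \<rho>) / exp \<epsilon> - \<rho> \<le> v * X A / exp \<epsilon> - \<rho>"
      by (intro diff_mono divide_right_mono) auto
    then have "\<theta> < v * X A / exp \<epsilon> - \<rho>"
      using approximator_intervals_separated[OF \<epsilon> \<rho>(1)] by (simp add: \<theta>_def)
    then have "{..\<theta>} \<inter> Q A = {}" by (auto simp: Q_def approximator_def)
    then have "F A + measure (K A) (Q A) = measure (K A) ({..\<theta>} \<union> Q A)"
      unfolding F_def by (intro K.finite_measure_Union[symmetric] Q_sets) (auto simp: K)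
    also have "\<dots> \<le> 1" by (rule K.prob_le_1)
    finally show ?thesis using success[of A] by simp
  qed

  \<comment> \<open>27/4 is the weaker of the two Chernoff exponents below, and 4/31 is the
    reciprocal of 1 + 27/4.\<close>
  have tail: "exp (- (27 / 4)) \<le> (4 / 31 :: real)"
  proof -
    have "31 / 4 \<le> exp (27 / 4 :: real)" using exp_ge_add_one_self[of "27 / 4 :: real"] by simp
    then show ?thesis by (simp add: exp_minus field_simps)
  qed

  \<comment> \<open>Concentration of the sum under both laws\<close>
  let ?E = "measure_pmf.expectation (bernoulli_bits N q)"
  let ?E' = "measure_pmf.expectation (bernoulli_bits N q')"
  have "?E F \<ge> 2 / 3 * (1 - 4 / 31)"
  proof -
    \<comment> \<open>Deviation 9\<rho>t of the count, that is 9\<rho> of the sum, tested with l =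
      3\<epsilon>. The exponent is 9\<rho>\<epsilon>t - 27\<rho>\<epsilon>t = -18\<rho>\<epsilon>t
      \<le> -9.\<close>
    define B where "B = {A. 27 * \<rho> * \<epsilon> * t \<le> 3 * \<epsilon> * (X A - real (card N) * q)}"
    have "measure_pmf.prob (bernoulli_bits N q) B
        \<le> exp (real (card N) * q * (3 * \<epsilon>)\<^sup>2 - 27 * \<rho> * \<epsilon> * t)"
      unfolding B_def X_def using q \<epsilon> by (intro bernoulli_bits_tail finN) auto
    also have "real (card N) * q * (3 * \<epsilon>)\<^sup>2 = 9 * (\<rho> * \<epsilon> * t)"
      using \<epsilon> unfolding cardN nq by (simp add: power2_eq_square)
    also have "exp (9 * (\<rho> * \<epsilon> * t) - 27 * \<rho> * \<epsilon> * t) \<le> exp (- (27 / 4))"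
      using \<rho>\<epsilon>t by (simp add: mult_ac)
    also note tail
    finally have prob_B: "measure_pmf.prob (bernoulli_bits N q) B \<le> 4 / 31" .
    have "2 / 3 * (1 - measure_pmf.prob (bernoulli_bits N q) B)
        = ?E (\<lambda>A. 2 / 3 * (1 - indicator B A))"
      using finN by simp
    also have "\<dots> \<le> ?E F"
    proof (rule integral_mono)
      fix A
      show "2 / 3 * (1 - indicator B A) \<le> F A"
      proof (cases "A \<in> B")
        case False
        then have "\<epsilon> * (X A - real n * q) < \<epsilon> * (9 * \<rho> * t)" by (simp add: B_def cardN algebra_simps)
        then have "X A < real n * q + 9 * \<rho> * t" using \<epsilon> by (simp add: mult_less_cancel_left)
        then have "2 / 3 \<le> F A" by (rule F_low)
        with False show ?thesis by simp
      qed (use F01 in simp)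
    qed (use finN in simp_all)
    finally show ?thesis using prob_B by simp
  qed
  moreover have "?E' F \<le> 1 / 3 + 2 / 3 * (4 / 31)"
  proof -
    \<comment> \<open>Negative l gives the lower tail. The mean has grown by 1 + \<delta> \<le> 3/2,
      so the exponent is at most -(27/2) \<rho>\<epsilon>t \<le> -27/4.\<close>
    define B where "B = {A. 27 * \<rho> * \<epsilon> * t \<le> (- 3 * \<epsilon>) * (X A - real (card N) * q')}"
    have "measure_pmf.prob (bernoulli_bits N q') B
        \<le> exp (real (card N) * q' * (- 3 * \<epsilon>)\<^sup>2 - 27 * \<rho> * \<epsilon> * t)"
      unfolding B_def X_def using q' \<epsilon> by (intro bernoulli_bits_tail finN) auto
    also have "\<dots> \<le> exp (- (27 / 4))"
    proof -
      have "real (card N) * q' * (- 3 * \<epsilon>)\<^sup>2 = (1 + \<delta>) * (real n * q) * (- 3 * \<epsilon>)\<^sup>2"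
        by (simp add: cardN q'_def)
      also have "\<dots> = 9 * ((1 + \<delta>) * (\<rho> * \<epsilon> * t))"
        using \<epsilon> by (simp only: nq) (simp add: power2_eq_square)
      also have "\<dots> \<le> 9 * (3 / 2 * (\<rho> * \<epsilon> * t))"
        using \<delta> \<rho>\<epsilon>t by (intro mult_left_mono mult_right_mono) auto
      finally have "real (card N) * q' * (- 3 * \<epsilon>)\<^sup>2 - 27 * \<rho> * \<epsilon> * t \<le> - (27 / 4)"
        using \<rho>\<epsilon>t by linarith
      then show ?thesis by (simp only: exp_le_cancel_iff)
    qed
    also note tail
    finally have prob_B: "measure_pmf.prob (bernoulli_bits N q') B \<le> 4 / 31" .
    have "?E' F \<le> ?E' (\<lambda>A. 1 / 3 + 2 / 3 * indicator B A)"
    proof (rule integral_mono)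
      fix A
      show "F A \<le> 1 / 3 + 2 / 3 * indicator B A"
      proof (cases "A \<in> B")
        case False
        then have "\<epsilon> * (real n * q' - 9 * \<rho> * t) < \<epsilon> * X A" by (simp add: B_def cardN algebra_simps)
        then have "X A > real n * q' - 9 * \<rho> * t" using \<epsilon> by (simp add: mult_less_cancel_left)
        then have "F A \<le> 1 / 3" by (rule F_high)
        with False show ?thesis by simp
      qed (use F01[of A] in simp)
    qed (use finN in simp_all)
    also have "\<dots> = 1 / 3 + 2 / 3 * measure_pmf.prob (bernoulli_bits N q') B"
      using finN by simp
    finally show ?thesis using prob_B by simp
  qed
  \<comment> \<open>The difference is at least 5/31 > 3/20. The part 1/20 is set aside for the
    additive term of \<open>bernoulli_bits_indistinguishable\<close>.\<close>
  ultimately have gap: "1 / 10 + 1 / 20 \<le> ?E F - ?E' F" by simp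

  \<comment> \<open>Reduction to the bits in \<open>V w\<close>\<close>
  define h where "h w A = measure (R (w, G A)) {..\<theta>}" for w A
  have intg: "integrable W (\<lambda>w. measure (R (w, g A w)) {..\<theta>})" for A
  proof (rule W.integrable_const_bound[where B = 1])
    show "AE w in W. norm (measure (R (w, g A w)) {..\<theta>}) \<le> 1"
    proof (rule AE_I2)
      fix w assume "w \<in> space W"
      then have "prob_space (R (w, g A w))"
        using measurable_space[OF kern[of A]] by (simp add: space_prob_algebra)
      from prob_space.prob_le_1[OF this] show "norm (measure (R (w, g A w)) {..\<theta>}) \<le> 1" by simp
    qed
    have "(\<lambda>w. measure (R (w, g A w)) {..\<theta>}) = (\<lambda>M. measure M {..\<theta>}) \<circ> (\<lambda>w. R (w, g A w))"
      by auto
    then show "(\<lambda>w. measure (R (w, g A w)) {..\<theta>}) \<in> borel_measurable W"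
      using measurable_comp[OF measurable_prob_algebraD[OF kern]
          measurable_measure_subprob_algebra[of "{..\<theta>}" borel]]
      by simp
  qed
  have F_int: "F A = (\<integral>w. measure (R (w, g A w)) {..\<theta>} \<partial>W)" for A
    unfolding F_def K_def
    by (rule W.measure_bind[where N = borel]) (use measurable_prob_algebraD[OF kern] in auto)
  \<comment> \<open>For fixed w the bits outside \<open>V w\<close> are never seen, so they
    integrate out. The remaining law has them equal to False, and there \<open>g A w\<close> is just
    \<open>G A\<close>.\<close>
  have marginal: "measure_pmf.expectation (bernoulli_bits N r) (\<lambda>A. measure (R (w, g A w)) {..\<theta>})
      = measure_pmf.expectation (bernoulli_bits (V w) r) (h w)" for r w
  proof -
    have "V w \<subseteq> N" by (auto simp: V_def)
    then show ?thesis
      by (subst Pi_pmf_subset[OF finN]) (auto simp: h_def g_eq)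
  qed
  \<comment> \<open>Correctness of \<open>R\<close> was used for each fixed \<open>A\<close>,
    averaging over w; indistinguishability is used for each fixed w, averaging over
    \<open>A\<close>. This exchange of order joins them.\<close>
  have int_E: "integrable W (\<lambda>w. measure_pmf.expectation (bernoulli_bits (V w) r) (h w))"
    and F_E: "measure_pmf.expectation (bernoulli_bits N r) F
      = (\<integral>w. measure_pmf.expectation (bernoulli_bits (V w) r) (h w) \<partial>W)" for r
    using integrable_pmf_expectation[where f = "\<lambda>A w. measure (R (w, g A w)) {..\<theta>}",
        OF finite_set_bernoulli_bits[OF finN, of r] intg]
      integral_pmf_expectation_swap[where f = "\<lambda>A w. measure (R (w, g A w)) {..\<theta>}",
        OF finite_set_bernoulli_bits[OF finN, of r] intg]
    by (simp_all add: marginal F_int[symmetric])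

  \<comment> \<open>From the gap to the expected size of \<open>V w\<close>\<close>
  define T where "T i = {w\<in>space W. t \<le> w i}" for i
  have T_meas [measurable]: "T i \<in> sets W" if "i \<in> N" for i
    using that unfolding T_def N_def by measurable
  have cardV: "real (card (V w)) = (\<Sum>i\<in>N. indicator (T i) w)" if "w \<in> space W" for w
  proof -
    have "(\<Sum>i\<in>N. indicator (T i) w :: real) = (\<Sum>i\<in>N. if t \<le> w i then 1 else 0)"
      using that by (intro sum.cong) (auto simp: T_def)
    then show ?thesis by (simp add: V_def sum.If_cases finN Int_def)
  qed
  have intT: "integrable W (\<lambda>w. indicator (T i) w :: real)" if "i \<in> N" for i
    using T_meas[OF that] by (simp add: W.emeasure_eq_measure)
  have "?E F - ?E' F = (\<integral>w. measure_pmf.expectation (bernoulli_bits (V w) q) (h w)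
      - measure_pmf.expectation (bernoulli_bits (V w) q') (h w) \<partial>W)"
    unfolding F_E by (rule Bochner_Integration.integral_diff[OF int_E int_E, symmetric])
  \<comment> \<open>Pointwise in w, \<open>h w\<close> is a [0,1]-valued test on the bits in
    \<open>V w\<close>. The bound is linear in the cardinality, hence integrates to a sum of tail
    probabilities.\<close>
  also have "\<dots> \<le> (\<integral>w. 20 * \<delta>\<^sup>2 * q * (\<Sum>i\<in>N. indicator (T i) w) + 1 / 20 \<partial>W)"
  proof (rule integral_mono)
    show "integrable W (\<lambda>w. measure_pmf.expectation (bernoulli_bits (V w) q) (h w)
      - measure_pmf.expectation (bernoulli_bits (V w) q') (h w))"
      by (intro Bochner_Integration.integrable_diff int_E)
    show "integrable W (\<lambda>w. 20 * \<delta>\<^sup>2 * q * (\<Sum>i\<in>N. indicator (T i) w) + 1 / 20)"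
      using intT by (intro Bochner_Integration.integrable_add integrable_mult_right
          Bochner_Integration.integrable_sum) auto
  next
    fix w assume w: "w \<in> space W"
    have "prob_space (R (w, G A))" for A
      using measurable_space[OF R', of "(w, G A)"] w G_space[of A]
      by (simp add: space_pair_measure space_W space_prob_algebra)
    from prob_space.prob_le_1[OF this]
    have "h w A \<le> 1" for A by (simp add: h_def)
    then show "measure_pmf.expectation (bernoulli_bits (V w) q) (h w)
      - measure_pmf.expectation (bernoulli_bits (V w) q') (h w)
      \<le> 20 * \<delta>\<^sup>2 * q * (\<Sum>i\<in>N. indicator (T i) w) + 1 / 20"
      unfolding q'_def cardV[OF w, symmetric] using q \<delta> finN
      by (intro bernoulli_bits_indistinguishable) (auto simp: h_def V_def)
  qed
  also have "\<dots> = 20 * \<delta>\<^sup>2 * q * (\<Sum>i\<in>N. measure W (T i)) + 1 / 20"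
    using intT by (simp add: W.prob_space Bochner_Integration.integral_sum)
  finally have "1 / 10 \<le> 20 * \<delta>\<^sup>2 * q * (\<Sum>i\<in>N. measure W (T i))" using gap by simp
  \<comment> \<open>Here 11520 = 20 * 24^2; dividing the remaining gap 1/10 by it yields the
    constant 115200.\<close>
  also have "20 * \<delta>\<^sup>2 * q = 11520 * \<epsilon> * \<rho> * t / real n"
    using \<epsilon> by (simp add: \<delta>_def q_def power2_eq_square)
  finally show ?thesis
    using \<epsilon> \<rho> t0 n by (simp add: T_def N_def field_simps)
qed


theorem theorem7p1:
  "\<exists>C::real. C > 0 \<and>
    (\<forall>(n::nat) (\<epsilon>::real) (\<rho>::real) (\<alpha>::real)
       (W :: (nat \<Rightarrow> real) measure) (R :: (nat \<Rightarrow> real) \<times> (nat \<Rightarrow> real) \<Rightarrow> real measure).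
      2 \<le> n \<longrightarrow> \<epsilon> \<in> {1 / real n..1 / 3} \<longrightarrow> \<rho> \<in> {1 / real n..1} \<longrightarrow>
      precision_law n W \<longrightarrow> randomized_algorithm n R \<longrightarrow> estimates_sum n \<epsilon> \<rho> W R \<longrightarrow>
      \<alpha> = max (\<rho> / \<epsilon>) (1 / (6 * \<epsilon>) ^ 4) \<longrightarrow>
      \<epsilon> \<in> {0<..<1 / 48} \<longrightarrow> \<alpha> \<le> real n / 16 \<longrightarrow>
      ennreal (1 / real n) * (\<Sum>i\<in>{1..n}. \<integral>\<^sup>+ w. ennreal (w i) \<partial>W)
        \<ge> ennreal (C / (\<epsilon> * \<rho>) * ln (real n / \<alpha>)))"
proof (intro exI[of _ "1 / 230400"] conjI allI impI)
  \<comment> \<open>Twice the constant 115200 of \<open>tail_sum_lower_bound\<close>; the factor 2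
    is lost in \<open>dyadic_sum_le\<close>.\<close>
  show "(0::real) < 1 / 230400" by simp
next
  fix n :: nat and \<epsilon> \<rho> \<alpha> :: real
    and W :: "(nat \<Rightarrow> real) measure" and R :: "(nat \<Rightarrow> real) \<times> (nat \<Rightarrow> real) \<Rightarrow> real measure"
  assume n: "2 \<le> n" and "\<epsilon> \<in> {1 / real n..1 / 3}" and "\<rho> \<in> {1 / real n..1}"
    and W: "precision_law n W" and R: "randomized_algorithm n R"
    and est: "estimates_sum n \<epsilon> \<rho> W R"
    and \<alpha>: "\<alpha> = max (\<rho> / \<epsilon>) (1 / (6 * \<epsilon>) ^ 4)"
    and "\<epsilon> \<in> {0<..<1 / 48}" and \<alpha>n: "\<alpha> \<le> real n / 16"
  have \<epsilon>: "0 < \<epsilon>" "\<epsilon> < 1 / 48" using \<open>\<epsilon> \<in> {0<..<1 / 48}\<close> by auto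
  have \<rho>: "0 < \<rho>" "\<rho> \<le> 1"
  proof -
    have "0 < 1 / real n" using n by simp
    also have "\<dots> \<le> \<rho>" using \<open>\<rho> \<in> {1 / real n..1}\<close> by simp
    finally show "0 < \<rho>" .
    show "\<rho> \<le> 1" using \<open>\<rho> \<in> {1 / real n..1}\<close> by simp
  qed
  interpret W: prob_space W using W by (simp add: precision_law_def)
  have sets_W [measurable_cong]: "sets W = sets (vecs n)"
    and pos: "AE w in W. \<forall>i\<in>{1..n}. 0 < w i"
    using W by (auto simp: precision_law_def)
  \<comment> \<open>The ratio of the upper to the lower limit on t in
    \<open>tail_sum_lower_bound\<close>.\<close>
  define y where "y = \<epsilon>\<^sup>2 * real n"
  have \<alpha>0: "0 < \<alpha>" using \<epsilon> \<rho> by (simp add: \<alpha> less_max_iff_disj)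
  have ratio: "16 \<le> real n / \<alpha>" using \<alpha>n \<alpha>0 by (simp add: field_simps)
  have n\<alpha>: "real n / \<alpha> \<le> y"
  proof -
    have "real n / \<alpha> \<le> real n / (1 / (6 * \<epsilon>) ^ 4)"
    proof (rule divide_left_mono)
      show "1 / (6 * \<epsilon>) ^ 4 \<le> \<alpha>" by (simp add: \<alpha>)
      show "0 < \<alpha> * (1 / (6 * \<epsilon>) ^ 4)" using \<alpha>0 \<epsilon> by simp
    qed simp
    also have "\<dots> = (6 * \<epsilon>) ^ 4 * real n" by simp
    \<comment> \<open>(6\<epsilon>)^4 = (36\<epsilon>)^2 \<epsilon>^2, and 36\<epsilon> < 1 since
      \<epsilon> < 1/48.\<close>
    also have "(6 * \<epsilon>) ^ 4 \<le> \<epsilon>\<^sup>2"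
    proof -
      have "(36 * \<epsilon>)\<^sup>2 \<le> 1\<^sup>2" using \<epsilon> by (intro power_mono) auto
      then have "(36 * \<epsilon>)\<^sup>2 * \<epsilon>\<^sup>2 \<le> 1 * \<epsilon>\<^sup>2" by (intro mult_right_mono) auto
      then show ?thesis by (simp add: eval_nat_numeral algebra_simps)
    qed
    finally show ?thesis by (simp add: y_def mult_right_mono)
  qed
  have y: "1 \<le> y" using ratio n\<alpha> by simp
  \<comment> \<open>The scales are j = 0, ..., floor (log 2 y); the successor counts j = 0 and
    ensures log 2 y \<le> J.\<close>
  define J where "J = Suc (nat \<lfloor>log 2 y\<rfloor>)"
  have J_pow: "2 ^ j \<le> y" if "j < J" for j
  proof -
    have "0 \<le> log 2 y" using y by simp
    then have "real j \<le> log 2 y" using that by (simp add: J_def le_nat_iff less_Suc_eq_le le_floor_iff)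
    then have "2 powr real j \<le> y" using y by (simp add: le_log_iff)
    then show ?thesis by (simp add: powr_realpow)
  qed
  have J_ge: "ln (real n / \<alpha>) \<le> real J"
  proof -
    have "ln (real n / \<alpha>) \<le> ln y" using n\<alpha> ratio by simp
    also have "\<dots> \<le> log 2 y"
    proof -
      have "ln 2 \<le> (1::real)" using ln_le_minus_one[of "2::real"] by simp
      then show ?thesis using y by (simp add: log_def field_simps mult_left_le)
    qed
    also have "\<dots> \<le> real J" unfolding J_def by linarith
    finally show ?thesis .
  qed

  \<comment> \<open>Tail mass at each dyadic scale\<close>
  define T where "T = 1 / (2 * \<epsilon> * \<rho>)"
  have T: "0 < T" using \<epsilon> \<rho> by (simp add: T_def)
  define P where "P j i = measure W {w\<in>space W. 2 ^ j * T \<le> w i}" for j i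
  \<comment> \<open>The tail bound decays like 1/t, so after weighting by t every scale contributes
    the same amount. This is the source of the logarithm.\<close>
  have tails: "real n / (115200 * \<epsilon> * \<rho>) \<le> 2 ^ j * T * (\<Sum>i\<in>{1..n}. P j i)" if "j < J" for j
  proof -
    have "1 * T \<le> 2 ^ j * T" using T by (intro mult_right_mono) auto
    moreover have "2 ^ j * T \<le> y * T" using J_pow[OF that] T by (intro mult_right_mono) auto
    moreover have "y * T = \<epsilon> * real n / (2 * \<rho>)"
      using \<epsilon> by (simp add: y_def T_def power2_eq_square)
    ultimately have "real n / (115200 * \<epsilon> * \<rho> * (2 ^ j * T)) \<le> (\<Sum>i\<in>{1..n}. P j i)"
      unfolding P_def using W R est \<epsilon> \<rho> by (intro tail_sum_lower_bound) (auto simp: T_def)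
    then have "2 ^ j * T * (real n / (115200 * \<epsilon> * \<rho> * (2 ^ j * T))) \<le> 2 ^ j * T * (\<Sum>i\<in>{1..n}. P j i)"
      using T by (intro mult_left_mono) auto
    then show ?thesis using T by simp
  qed
  \<comment> \<open>Layer-cake bound: half the sum of the dyadic scales reached by
    \<open>w i\<close> is at most \<open>w i\<close>. The nonnegative integral also covers an
    infinite expectation.\<close>
  have layer: "ennreal (\<Sum>j<J. 2 ^ j * T / 2 * P j i) \<le> (\<integral>\<^sup>+ w. ennreal (w i) \<partial>W)" if "i \<in> {1..n}" for i
  proof -
    define S where "S j = {w\<in>space W. 2 ^ j * T \<le> w i}" for j
    have S [measurable]: "S j \<in> sets W" for j unfolding S_def using that by measurable
    have "ennreal (\<Sum>j<J. 2 ^ j * T / 2 * P j i)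
        = (\<Sum>j<J. ennreal (2 ^ j * T / 2) * emeasure W (S j))"
      using T by (subst sum_ennreal[symmetric])
        (auto simp: P_def S_def[symmetric] W.emeasure_eq_measure simp flip: ennreal_mult simp del: sum_ennreal)
    also have "\<dots> = (\<integral>\<^sup>+ w. (\<Sum>j<J. ennreal (2 ^ j * T / 2) * indicator (S j) w) \<partial>W)"
      by (subst nn_integral_sum) (auto simp: nn_integral_cmult_indicator)
    also have "\<dots> \<le> (\<integral>\<^sup>+ w. ennreal (w i) \<partial>W)"
    proof (rule nn_integral_mono_AE)
      show "AE w in W. (\<Sum>j<J. ennreal (2 ^ j * T / 2) * indicator (S j) w) \<le> ennreal (w i)"
        using pos AE_space
      proof eventually_elim
        case (elim w)
        have "(\<Sum>j<J. ennreal (2 ^ j * T / 2) * indicator (S j) w)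
            = (\<Sum>j<J. ennreal (2 ^ j * T / 2 * (if 2 ^ j * T \<le> w i then 1 else 0)))"
          using elim by (intro sum.cong) (auto simp: S_def)
        also have "\<dots> = ennreal ((\<Sum>j<J. 2 ^ j * T * (if 2 ^ j * T \<le> w i then 1 else 0)) / 2)"
          using T by (subst sum_ennreal) (auto simp: sum_divide_distrib)
        also have "\<dots> \<le> ennreal (w i)"
        proof (rule ennreal_leI)
          have "0 \<le> w i" using elim(1) that by (blast intro: less_imp_le)
          then show "(\<Sum>j<J. 2 ^ j * T * (if 2 ^ j * T \<le> w i then 1 else 0)) / 2 \<le> w i"
            using dyadic_sum_le[of "w i" T J] T by simp
        qed
        finally show ?case .
      qed
    qed
    finally show ?thesis .
  qed

  \<comment> \<open>Summation over scales and coordinates\<close>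
  have P0: "0 \<le> P j i" for j i by (simp add: P_def)
  have "1 / 230400 / (\<epsilon> * \<rho>) * ln (real n / \<alpha>) \<le> 1 / 230400 / (\<epsilon> * \<rho>) * real J"
    using J_ge \<epsilon> \<rho> by (intro mult_left_mono) auto
  also have "\<dots> = 1 / real n * (\<Sum>j<J. real n / (115200 * \<epsilon> * \<rho>) / 2)"
    using n \<epsilon> \<rho> by (simp add: field_simps)
  also have "\<dots> \<le> 1 / real n * (\<Sum>j<J. 2 ^ j * T * (\<Sum>i\<in>{1..n}. P j i) / 2)"
    using tails by (intro mult_left_mono sum_mono divide_right_mono) auto
  also have "(\<Sum>j<J. 2 ^ j * T * (\<Sum>i\<in>{1..n}. P j i) / 2)
      = (\<Sum>i\<in>{1..n}. \<Sum>j<J. 2 ^ j * T / 2 * P j i)"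
    by (subst sum.swap) (simp add: sum_distrib_left sum_divide_distrib)
  finally have "ennreal (1 / 230400 / (\<epsilon> * \<rho>) * ln (real n / \<alpha>))
      \<le> ennreal (1 / real n * (\<Sum>i\<in>{1..n}. \<Sum>j<J. 2 ^ j * T / 2 * P j i))"
    by (rule ennreal_leI)
  also have "\<dots> = ennreal (1 / real n) * (\<Sum>i\<in>{1..n}. ennreal (\<Sum>j<J. 2 ^ j * T / 2 * P j i))"
    using T P0
    by (subst sum_ennreal) (intro sum_nonneg mult_nonneg_nonneg ennreal_mult; simp)+
  also have "\<dots> \<le> ennreal (1 / real n) * (\<Sum>i\<in>{1..n}. \<integral>\<^sup>+ w. ennreal (w i) \<partial>W)"
    by (intro mult_left_mono sum_mono layer) auto
  finally show "ennreal (1 / 230400 / (\<epsilon> * \<rho>) * ln (real n / \<alpha>))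
      \<le> ennreal (1 / real n) * (\<Sum>i\<in>{1..n}. \<integral>\<^sup>+ w. ennreal (w i) \<partial>W)" .
qed

end
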